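(* Let $\mathbf{V}=\{V^n\}_{n=1}^\infty$ be a general source and $\mathbf{W}=\{W^n\}_{n=1}^\infty$ a general channel. The following two conditions are equivalent: 1) For some channel input $\mathbf{X}=\{X^n\}_{n=1}^\infty$, which may be arbitrarily correlated to the output of the source $\mathbf{V}$, and for some sequence $\{\gamma_n\}_{n=1}^\infty$ of real numbers satisfying $\gamma_n>0$, $\gamma_n\to0$ and $n\gamma_n\to\infty$ $(n\to\infty)$, it holds that $$\lim_{n\to\infty}\Pr\left\{\frac1n\log\frac{W^n(Y^n|X^n)}{P_{Y^n}(Y^n)}\le\frac1n\log\frac1{P_{V^n}(V^n)}+\gamma_n\right\}=0,$$ where $Y^n$ is the channel output via $W^n$ due to the channel input $X^n$. 2) (Strict domination) For some channel input $\mathbf{X}=\{X^n\}_{n=1}^\infty$, which may be arbitrarily correlated to the output of the source $\mathbf{V}$, for some sequence $\{c_n\}_{n=1}^\infty$ of real numbers and some sequence $\{\gamma_n\}_{n=1}^\infty$ of real numbers satisfying $\gamma_n>0$, $\gamma_n\to0$ and $n\gamma_n\to\infty$ $(n\to\infty)$, it holds that $$\lim_{n\to\infty}\left(\Pr\left\{\frac1n\log\frac1{P_{V^n}(V^n)}\ge c_n\right\}+\Pr\left\{\frac1n\log\frac{W^n(Y^n|X^n)}{P_{Y^n}(Y^n)}\le c_n+\gamma_n\right\}\right)=0,$$ where $Y^n$ is the channel output via $W^n$ due to the channel input $X^n$.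
   Context: A general source $\mathbf{V}=\{V^n\}_{n=1}^\infty$ is an arbitrary sequence of random variables $V^n=(V_1^{(n)},\dots,V_n^{(n)})$ with values in $\mathcal{V}^n$, where the source alphabet $\mathcal{V}$ is a countably infinite set; no consistency between different $n$ is required. A general channel $\mathbf{W}=\{W^n(\cdot|\cdot):\mathcal{X}^n\to\mathcal{Y}^n\}_{n=1}^\infty$ is an arbitrary sequence of transition probabilities (Markov kernels) $W^n$ from $\mathcal{X}^n$ to $\mathcal{Y}^n$, where $\mathcal{X},\mathcal{Y}$ are arbitrary abstract (measurable) alphabets. $P_Z$ denotes the distribution of $Z$. Logarithms are natural. A channel input $\mathbf{X}=\{X^n\}$ is a sequence of random variables $X^n$ with values in $\mathcal{X}^n$. "$Y^n$ is the channel output via $W^n$ due to the input $X^n$" means that the conditional distribution of $Y^n$ given $X^n=\mathbf{x}$ is $W^n(\cdot|\mathbf{x})$ and $V^n\to X^n\to Y^n$ is a Markov chain. For abstract alphabets, $\frac{W^n(Y^n|X^n)}{P_{Y^n}(Y^n)}$ means $g(Y^n|X^n)$, where $g(\mathbf{y}|\mathbf{x})=\frac{W^n(d\mathbf{y}|\mathbf{x})}{P_{Y^n}(d\mathbf{y})}=\frac{P_{X^nY^n}(d\mathbf{x},d\mathbf{y})}{P_{X^n}(d\mathbf{x})P_{Y^n}(d\mathbf{y})}$ is the Radon-Nikodym derivative, measurable in $(\mathbf{x},\mathbf{y})$. *)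

theory Defs
  imports "HOL-Probability.Probability"
begin

definition block_space :: "'a measure \<Rightarrow> nat \<Rightarrow> (nat \<Rightarrow> 'a) measure" where
  "block_space M n = (\<Pi>\<^sub>M i\<in>{1..n}. M)"

text \<open>Sources, inputs and outputs enter only through their distributions, so a sequence of random
  variables is represented by the sequence of its laws.  The laws for different block lengths
  are unrelated, and the index \<open>n = 0\<close> is unconstrained since the sequences start at \<open>n = 1\<close>.\<close>

definition general_source :: "'v set \<Rightarrow> (nat \<Rightarrow> (nat \<Rightarrow> 'v) measure) \<Rightarrow> bool" where
  "general_source A PV \<longleftrightarrow>
     (\<forall>n\<ge>1. PV n \<in> space (prob_algebra (block_space (count_space A) n)))"

definition general_channel ::
    "'x measure \<Rightarrow> 'y measure \<Rightarrow> (nat \<Rightarrow> (nat \<Rightarrow> 'x) \<Rightarrow> (nat \<Rightarrow> 'y) measure) \<Rightarrow> bool" where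
  "general_channel MX MY W \<longleftrightarrow>
     (\<forall>n\<ge>1. W n \<in> block_space MX n \<rightarrow>\<^sub>M prob_algebra (block_space MY n))"

text \<open>A channel input that may be arbitrarily correlated with the source is a coupling:
  \<open>Q n\<close> is the joint law of \<open>(V\<^sup>n, X\<^sup>n)\<close>, constrained only by its first marginal.\<close>

definition channel_input ::
    "'v set \<Rightarrow> (nat \<Rightarrow> (nat \<Rightarrow> 'v) measure) \<Rightarrow> 'x measure
      \<Rightarrow> (nat \<Rightarrow> ((nat \<Rightarrow> 'v) \<times> (nat \<Rightarrow> 'x)) measure) \<Rightarrow> bool" where
  "channel_input A PV MX Q \<longleftrightarrow>
     (\<forall>n\<ge>1. Q n \<in> space (prob_algebra (block_space (count_space A) n \<Otimes>\<^sub>M block_space MX n)) \<and>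
            distr (Q n) (block_space (count_space A) n) fst = PV n)"

text \<open>The law of \<open>((V, X), Y)\<close> when \<open>(V, X)\<close> has law \<open>Q\<close> and \<open>Y\<close> is the output of the kernel \<open>K\<close>
  with values in \<open>N\<close>.  The kernel sees only the \<open>X\<close>-component; this is the Markov chain condition
  \<open>V \<rightarrow> X \<rightarrow> Y\<close>.\<close>

definition joint_law ::
    "('v \<times> 'x) measure \<Rightarrow> 'y measure \<Rightarrow> ('x \<Rightarrow> 'y measure) \<Rightarrow> (('v \<times> 'x) \<times> 'y) measure" where
  "joint_law Q N K = Q \<bind> (\<lambda>z. distr (K (snd z)) (Q \<Otimes>\<^sub>M N) (Pair z))"

definition input_law :: "'x measure \<Rightarrow> (('v \<times> 'x) \<times> 'y) measure \<Rightarrow> 'x measure" where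
  "input_law L J = distr J L (\<lambda>((v, x), y). x)"

definition output_law :: "'y measure \<Rightarrow> (('v \<times> 'x) \<times> 'y) measure \<Rightarrow> 'y measure" where
  "output_law N J = distr J N (\<lambda>((v, x), y). y)"

definition input_output_law ::
    "'x measure \<Rightarrow> 'y measure \<Rightarrow> (('v \<times> 'x) \<times> 'y) measure \<Rightarrow> ('x \<times> 'y) measure" where
  "input_output_law L N J = distr J (L \<Otimes>\<^sub>M N) (\<lambda>((v, x), y). (x, y))"

text \<open>On abstract alphabets \<open>W(y | x) / P\<^sub>Y(y)\<close> denotes the derivative
  \<open>dP\<^sub>X\<^sub>Y / d(P\<^sub>X \<otimes> P\<^sub>Y)\<close>, which exists iff \<open>P\<^sub>X\<^sub>Y\<close> is absolutely continuous with respect to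
  \<open>P\<^sub>X \<otimes> P\<^sub>Y\<close>.\<close>

definition has_channel_density ::
    "'x measure \<Rightarrow> 'y measure \<Rightarrow> (('v \<times> 'x) \<times> 'y) measure \<Rightarrow> bool" where
  "has_channel_density L N J \<longleftrightarrow>
     absolutely_continuous (input_law L J \<Otimes>\<^sub>M output_law N J) (input_output_law L N J)"

text \<open>Under absolute continuity the derivative lies in \<open>(0, \<infinity>)\<close> outside a \<open>P\<^sub>X\<^sub>Y\<close>-null set, so
  neither \<open>enn2real \<infinity> = 0\<close> nor the value of \<open>ln 0\<close> influences probabilities computed from
  \<open>ln (channel_density L N J x y)\<close>.\<close>

definition channel_density ::
    "'x measure \<Rightarrow> 'y measure \<Rightarrow> (('v \<times> 'x) \<times> 'y) measure \<Rightarrow> 'x \<Rightarrow> 'y \<Rightarrow> real" where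
  "channel_density L N J x y =
     enn2real (RN_deriv (input_law L J \<Otimes>\<^sub>M output_law N J) (input_output_law L N J) (x, y))"

definition admissible_gap :: "(nat \<Rightarrow> real) \<Rightarrow> bool" where
  "admissible_gap \<gamma> \<longleftrightarrow>
     (\<forall>n\<ge>1. \<gamma> n > 0) \<and> \<gamma> \<longlonglongrightarrow> 0 \<and> filterlim (\<lambda>n. real n * \<gamma> n) at_top sequentially"

end

theory Submission
  imports Defs "HOL-Real_Asymp.Real_Asymp"
begin

text \<open>Write \<open>h\<close> for the normalised source entropy density and \<open>i\<close> for the normalised channel
  information density.  If \<open>i \<le> h + \<gamma>\<close>, then \<open>h \<ge> c\<close> or \<open>i \<le> c + \<gamma>\<close>, so the union bound derives
  the first condition from strict domination, with the same input and the same gap.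

  The converse is a change of input.  Let \<open>p\<^sub>n\<close> be the
  probability in the first condition, and choose \<open>\<epsilon>\<^sub>n \<longrightarrow> 0\<close> so slowly that \<open>p\<^sub>n / \<epsilon>\<^sub>n \<longrightarrow> 0\<close> and
  \<open>ln (1 / \<epsilon>\<^sub>n) \<le> n \<gamma>\<^sub>n / 4\<close>; this is possible because \<open>n \<gamma>\<^sub>n \<longrightarrow> \<infinity>\<close>.  Let \<open>c\<^sub>n\<close> be the upper
  \<open>\<epsilon>\<^sub>n\<close>-quantile of \<open>h\<close>, up to an error \<open>\<gamma>\<^sub>n / 4\<close>: the event \<open>h \<ge> c\<^sub>n\<close> has probability at most
  \<open>\<epsilon>\<^sub>n\<close>, while \<open>E = {h \<ge> c\<^sub>n - \<gamma>\<^sub>n / 4}\<close> has probability more than \<open>\<epsilon>\<^sub>n\<close> (\<open>tail_threshold\<close>).  The new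
  input has the conditional law of the old one given \<open>E\<close> and is independent of the source.

  Conditioning on \<open>E\<close> multiplies probabilities by at most \<open>1 / \<epsilon>\<^sub>n\<close>.  This has two effects.
  Given \<open>E\<close>, the inequality \<open>i > h + \<gamma>\<^sub>n\<close>, which on \<open>E\<close> implies \<open>i > c\<^sub>n + 3 \<gamma>\<^sub>n / 4\<close>, fails with
  probability at most \<open>p\<^sub>n / \<epsilon>\<^sub>n\<close>.  Moreover the new output law is at most \<open>1 / \<epsilon>\<^sub>n\<close> times the old one, so passing to
  the new output law in the denominator of \<open>W(y | x) / P\<^sub>Y(y)\<close> lowers \<open>i\<close> by at most \<open>\<gamma>\<^sub>n / 4\<close>
  (\<open>channel_density_loss\<close>).  Hence the new information density exceeds \<open>c\<^sub>n + \<gamma>\<^sub>n / 2\<close> with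
  probability tending to one, and the new gap is \<open>\<gamma>\<^sub>n / 2\<close> (\<open>concentrate_input\<close>).\<close>

section \<open>The laws generated by a kernel and a coupling\<close>

locale kernel_channel =
  fixes L :: "'x measure" and N :: "'y measure" and K :: "'x \<Rightarrow> 'y measure"
  assumes kernel: "K \<in> L \<rightarrow>\<^sub>M prob_algebra N"
begin

lemma kernel_subprob [measurable]: "K \<in> L \<rightarrow>\<^sub>M subprob_algebra N"
  using kernel by (rule measurable_prob_algebraD)

lemma kernel_point:
  assumes "x \<in> space L"
  shows "sets (K x) = sets N" "prob_space (K x)"
  using measurable_space[OF kernel assms] by (auto simp: space_prob_algebra)

lemma nn_integral_kernel_measurable:
  assumes f [measurable]: "f \<in> borel_measurable (L \<Otimes>\<^sub>M N)"
  shows "(\<lambda>x. \<integral>\<^sup>+y. f (x, y) \<partial>K x) \<in> borel_measurable L"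
  by (rule nn_integral_measurable_subprob_algebra2[OF _ kernel_subprob]) simp

end

text \<open>One block of the transmission problem: \<open>Q\<close> couples a source word in \<open>Vs\<close> with a channel input
  in \<open>L\<close>.  All laws below are determined by \<open>Q\<close> and the kernel through iterated integrals.\<close>

locale coded_channel = kernel_channel L N K
  for L :: "'x measure" and N :: "'y measure" and K :: "'x \<Rightarrow> 'y measure" +
  fixes Vs :: "'v measure" and Q :: "('v \<times> 'x) measure"
  assumes coupling: "Q \<in> space (prob_algebra (Vs \<Otimes>\<^sub>M L))"
begin

abbreviation "J \<equiv> joint_law Q N K"
abbreviation "PX \<equiv> input_law L J"
abbreviation "PY \<equiv> output_law N J"
abbreviation "PXY \<equiv> input_output_law L N J"

lemma sets_Q [measurable_cong]: "sets Q = sets (Vs \<Otimes>\<^sub>M L)"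
  and prob_space_Q: "prob_space Q"
  using coupling by (auto simp: space_prob_algebra)

sublocale Q: prob_space Q by (rule prob_space_Q)

lemma space_Q: "space Q = space Vs \<times> space L"
  by (simp add: sets_eq_imp_space_eq[OF sets_Q] space_pair_measure)

lemma snd_in_space: "z \<in> space Q \<Longrightarrow> snd z \<in> space L"
  by (auto simp: space_Q)

lemma attach_output_measurable:
  "(\<lambda>z. distr (K (snd z)) (Q \<Otimes>\<^sub>M N) (Pair z)) \<in> Q \<rightarrow>\<^sub>M prob_algebra (Q \<Otimes>\<^sub>M N)"
proof (rule measurable_distr_prob_space2)
  have "snd \<in> Q \<rightarrow>\<^sub>M L" by measurable
  then show "(\<lambda>z. K (snd z)) \<in> Q \<rightarrow>\<^sub>M prob_algebra N"
    by (rule measurable_compose[OF _ kernel])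
qed simp

lemma joint_law_in: "J \<in> space (prob_algebra (Q \<Otimes>\<^sub>M N))"
proof -
  have "Q \<in> space (prob_algebra Q)"
    by (simp add: space_prob_algebra prob_space_Q)
  from measurable_bind_prob_space[OF measurable_const[OF this] attach_output_measurable]
  have "(\<lambda>_. J) \<in> Q \<rightarrow>\<^sub>M prob_algebra (Q \<Otimes>\<^sub>M N)"
    unfolding joint_law_def .
  with Q.not_empty show ?thesis
    by (auto dest: measurable_space)
qed

lemma sets_joint_law [measurable_cong]: "sets J = sets ((Vs \<Otimes>\<^sub>M L) \<Otimes>\<^sub>M N)"
  and prob_space_joint_law: "prob_space J"
  using joint_law_in sets_pair_measure_cong[OF sets_Q refl] by (auto simp: space_prob_algebra)

sublocale J: prob_space J by (rule prob_space_joint_law)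

lemma nn_integral_joint_law:
  assumes f [measurable]: "f \<in> borel_measurable ((Vs \<Otimes>\<^sub>M L) \<Otimes>\<^sub>M N)"
  shows "(\<integral>\<^sup>+w. f w \<partial>J) = (\<integral>\<^sup>+z. \<integral>\<^sup>+y. f (z, y) \<partial>K (snd z) \<partial>Q)"
proof -
  have "(\<integral>\<^sup>+w. f w \<partial>J) =
      (\<integral>\<^sup>+z. \<integral>\<^sup>+w. f w \<partial>distr (K (snd z)) (Q \<Otimes>\<^sub>M N) (Pair z) \<partial>Q)"
    unfolding joint_law_def
    by (rule nn_integral_bind[OF _ measurable_prob_algebraD[OF attach_output_measurable]])
      measurable
  also have "\<dots> = (\<integral>\<^sup>+z. \<integral>\<^sup>+y. f (z, y) \<partial>K (snd z) \<partial>Q)"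
  proof (rule nn_integral_cong)
    fix z assume z: "z \<in> space Q"
    then have "snd z \<in> space L" by (rule snd_in_space)
    then have K: "sets (K (snd z)) = sets N"
      by (rule kernel_point)
    have "Pair z \<in> K (snd z) \<rightarrow>\<^sub>M Q \<Otimes>\<^sub>M N"
      unfolding measurable_cong_sets[OF K refl] using z by (rule measurable_Pair1')
    then show "(\<integral>\<^sup>+w. f w \<partial>distr (K (snd z)) (Q \<Otimes>\<^sub>M N) (Pair z)) = (\<integral>\<^sup>+y. f (z, y) \<partial>K (snd z))"
      by (rule nn_integral_distr) measurable
  qed
  finally show ?thesis .
qed

lemma nn_integral_joint_law_coupling:
  assumes f [measurable]: "f \<in> borel_measurable (Vs \<Otimes>\<^sub>M L)"
  shows "(\<integral>\<^sup>+w. f (fst w) \<partial>J) = (\<integral>\<^sup>+z. f z \<partial>Q)"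
proof -
  have "(\<integral>\<^sup>+w. f (fst w) \<partial>J) = (\<integral>\<^sup>+z. \<integral>\<^sup>+y. f z \<partial>K (snd z) \<partial>Q)"
    by (subst nn_integral_joint_law[OF measurable_compose[OF measurable_fst f]]) simp
  also have "\<dots> = (\<integral>\<^sup>+z. f z \<partial>Q)"
  proof (rule nn_integral_cong)
    fix z assume "z \<in> space Q"
    then have "snd z \<in> space L" by (rule snd_in_space)
    then show "(\<integral>\<^sup>+y. f z \<partial>K (snd z)) = f z"
      using kernel_point(2) by (simp add: prob_space.emeasure_space_1)
  qed
  finally show ?thesis .
qed

lemma distr_coupling: "distr J (Vs \<Otimes>\<^sub>M L) fst = Q"
proof (rule measure_eqI)
  fix B assume "B \<in> sets (distr J (Vs \<Otimes>\<^sub>M L) fst)"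
  then have B [measurable]: "B \<in> sets (Vs \<Otimes>\<^sub>M L)" by simp
  have "(\<integral>\<^sup>+z. indicator B z \<partial>distr J (Vs \<Otimes>\<^sub>M L) fst) = (\<integral>\<^sup>+w. indicator B (fst w) \<partial>J)"
    by (rule nn_integral_distr) measurable
  also have "\<dots> = (\<integral>\<^sup>+z. indicator B z \<partial>Q)"
    by (rule nn_integral_joint_law_coupling) measurable
  finally show "emeasure (distr J (Vs \<Otimes>\<^sub>M L) fst) B = emeasure Q B"
    using B by (simp add: sets_Q)
qed (simp add: sets_Q)

lemma laws_by_projections:
  "PX = distr J L (\<lambda>w. snd (fst w))" "PY = distr J N snd"
  "PXY = distr J (L \<Otimes>\<^sub>M N) (\<lambda>w. (snd (fst w), snd w))"
  unfolding input_law_def output_law_def input_output_law_def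
  by (auto intro!: arg_cong[where f="distr J _"])

lemma input_law_eq: "PX = distr Q L snd"
proof -
  have "PX = distr (distr J (Vs \<Otimes>\<^sub>M L) fst) L snd"
    unfolding laws_by_projections by (subst distr_distr) (simp_all add: comp_def)
  then show ?thesis by (simp add: distr_coupling)
qed

lemma sets_laws [measurable_cong, simp]:
  "sets PX = sets L" "sets PY = sets N" "sets PXY = sets (L \<Otimes>\<^sub>M N)"
  by (simp_all add: input_law_def output_law_def input_output_law_def)

sublocale X: prob_space PX
  unfolding laws_by_projections by (rule J.prob_space_distr) measurable

sublocale Y: prob_space PY
  unfolding laws_by_projections by (rule J.prob_space_distr) measurable

sublocale XY: prob_space PXY
  unfolding laws_by_projections by (rule J.prob_space_distr) measurable

sublocale XxY: pair_prob_space PX PY ..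

lemma sets_product_law [simp]: "sets (PX \<Otimes>\<^sub>M PY) = sets (L \<Otimes>\<^sub>M N)"
  by (intro sets_pair_measure_cong sets_laws)

lemma nn_integral_input_output_law_joint:
  assumes f [measurable]: "f \<in> borel_measurable (L \<Otimes>\<^sub>M N)"
  shows "(\<integral>\<^sup>+p. f p \<partial>PXY) = (\<integral>\<^sup>+w. f (snd (fst w), snd w) \<partial>J)"
  unfolding laws_by_projections by (rule nn_integral_distr) measurable

text \<open>Only the input marginal of the coupling enters: by the Markov chain condition, the source is
  invisible to the pair of input and output.  This is what allows the coupling to be replaced by an
  independent one.\<close>

lemma nn_integral_input_output_law:
  assumes f [measurable]: "f \<in> borel_measurable (L \<Otimes>\<^sub>M N)"
  shows "(\<integral>\<^sup>+p. f p \<partial>PXY) = (\<integral>\<^sup>+x. \<integral>\<^sup>+y. f (x, y) \<partial>K x \<partial>PX)"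
proof -
  note nn_integral_kernel_measurable[OF f, measurable]
  show ?thesis
    by (simp add: nn_integral_input_output_law_joint nn_integral_joint_law input_law_eq
        nn_integral_distr)
qed

lemma nn_integral_output_law:
  assumes f [measurable]: "f \<in> borel_measurable N"
  shows "(\<integral>\<^sup>+y. f y \<partial>PY) = (\<integral>\<^sup>+p. f (snd p) \<partial>PXY)"
proof -
  have "(\<integral>\<^sup>+y. f y \<partial>PY) = (\<integral>\<^sup>+w. f (snd w) \<partial>J)"
    unfolding laws_by_projections by (rule nn_integral_distr) measurable
  also have "\<dots> = (\<integral>\<^sup>+p. f (snd p) \<partial>PXY)"
    by (subst nn_integral_input_output_law_joint) simp_all
  finally show ?thesis .
qed

lemma output_law_eq: "PY = distr PXY N snd"
  unfolding laws_by_projections by (subst distr_distr) (simp_all add: comp_def)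

abbreviation "G \<equiv> RN_deriv (PX \<Otimes>\<^sub>M PY) PXY"

lemma density_G:
  assumes "has_channel_density L N J"
  shows "density (PX \<Otimes>\<^sub>M PY) G = PXY"
  using assms unfolding has_channel_density_def
  by (intro XxY.density_RN_deriv) simp_all

lemma G_measurable [measurable]: "G \<in> borel_measurable (L \<Otimes>\<^sub>M N)"
proof -
  have "G \<in> borel_measurable (PX \<Otimes>\<^sub>M PY)" by (rule borel_measurable_RN_deriv)
  then show ?thesis
    by (simp only: measurable_cong_sets[OF sets_product_law refl])
qed

lemma channel_density_measurable [measurable]:
  "case_prod (channel_density L N J) \<in> borel_measurable (L \<Otimes>\<^sub>M N)"
  unfolding channel_density_def split_beta' by measurable

lemma channel_density_joint_measurable:
  "(\<lambda>w. channel_density L N J (snd (fst w)) (snd w)) \<in> borel_measurable ((Vs \<Otimes>\<^sub>M L) \<Otimes>\<^sub>M N)"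
  using measurable_compose[of "\<lambda>w. (snd (fst w), snd w)", OF _ channel_density_measurable] by simp

text \<open>The conversion of the derivative to a real number, and its logarithm, are therefore faithful
  almost everywhere under the input-output law.\<close>

lemma AE_G_pos_finite:
  assumes "has_channel_density L N J"
  shows "AE p in PXY. 0 < G p \<and> G p < \<infinity>"
proof -
  have "AE p in PX \<Otimes>\<^sub>M PY. G p \<noteq> \<infinity>"
    using assms unfolding has_channel_density_def
    by (intro XxY.RN_deriv_finite) (simp_all add: XY.sigma_finite_measure_axioms)
  then have "AE p in density (PX \<Otimes>\<^sub>M PY) G. 0 < G p \<and> G p < \<infinity>"
    by (subst AE_density) (auto simp: top.not_eq_extremum)
  then show ?thesis
    unfolding density_G[OF assms] .
qed

end

section \<open>Measures dominated by a multiple of another measure\<close>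

lemma nn_integral_le_of_dominated:
  assumes sets: "sets M = sets M'"
    and le: "\<And>B. B \<in> sets M \<Longrightarrow> emeasure M' B \<le> C * emeasure M B"
    and f: "f \<in> borel_measurable M"
  shows "(\<integral>\<^sup>+x. f x \<partial>M') \<le> C * (\<integral>\<^sup>+x. f x \<partial>M)"
proof -
  have "M' \<le> scale_measure C M"
    using sets le by (subst le_measure) auto
  then have "(\<integral>\<^sup>+x. f x \<partial>M') \<le> (\<integral>\<^sup>+x. f x \<partial>scale_measure C M)"
    using sets by (intro nn_integral_mono_measure) auto
  then show ?thesis
    by (simp add: nn_integral_scale_measure[OF f])
qed

lemma absolutely_continuous_of_dominated:
  assumes sets: "sets M = sets M'"
    and le: "\<And>B. B \<in> sets M \<Longrightarrow> emeasure M' B \<le> C * emeasure M B"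
  shows "absolutely_continuous M M'"
  unfolding absolutely_continuous_def
proof
  fix B assume "B \<in> null_sets M"
  then show "B \<in> null_sets M'"
    using sets le[of B] by (auto simp: null_sets_def)
qed

text \<open>On the set \<open>{f > C}\<close> the excess \<open>f - C\<close> is positive, but its integral is at most zero by the
  domination hypothesis applied to that set; finiteness of \<open>M\<close> makes the subtraction legitimate.\<close>

lemma AE_density_le_of_dominated:
  assumes "finite_measure M" and C: "C < \<infinity>"
    and f [measurable]: "f \<in> borel_measurable M"
    and le: "\<And>B. B \<in> sets M \<Longrightarrow> emeasure (density M f) B \<le> C * emeasure M B"
  shows "AE x in M. f x \<le> C"
proof -
  interpret finite_measure M by fact
  define B where "B = {x \<in> space M. C < f x}"
  have B [measurable]: "B \<in> sets M" unfolding B_def by measurable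
  have C_B: "C * emeasure M B < \<infinity>"
    using C emeasure_finite[of B, unfolded top.not_eq_extremum] by (simp add: ennreal_mult_less_top)
  then have fin: "(\<integral>\<^sup>+x. C * indicator B x \<partial>M) < \<infinity>"
    by (simp add: nn_integral_cmult)
  have "(\<integral>\<^sup>+x. f x * indicator B x - C * indicator B x \<partial>M) =
      (\<integral>\<^sup>+x. f x * indicator B x \<partial>M) - (\<integral>\<^sup>+x. C * indicator B x \<partial>M)"
    using fin by (intro nn_integral_diff) (auto simp: B_def split: split_indicator intro!: AE_I2)
  also have "\<dots> = emeasure (density M f) B - C * emeasure M B"
    by (simp add: emeasure_density nn_integral_cmult)
  also have "\<dots> = 0"
    using le[OF B] le_less_trans[OF le[OF B] C_B] by (intro diff_eq_0_ennreal) simp_all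
  finally have "AE x in M. f x * indicator B x - C * indicator B x = 0"
    by (subst (asm) nn_integral_0_iff_AE) auto
  then show ?thesis
    by (rule AE_mp) (auto intro!: AE_I2 simp: B_def not_le ennreal_minus_eq_0 split: split_indicator_asm)
qed

section \<open>Replacing the input by a dominated one\<close>

text \<open>Two couplings for the same kernel, where the input law of the second is at most \<open>C\<close> times that
  of the first.  Conditioning on an event of probability at least \<open>1 / C\<close> is the instance of
  interest.\<close>

locale dominated_input =
  coded_channel L N K Vs Q + D: coded_channel L N K Vs Q'
  for L :: "'x measure" and N :: "'y measure" and K :: "'x \<Rightarrow> 'y measure"
    and Vs :: "'v measure" and Q Q' :: "('v \<times> 'x) measure" +
  fixes C :: real
  assumes C_pos: "0 < C"
    and dominated: "\<And>B. B \<in> sets L \<Longrightarrow> emeasure D.PX B \<le> ennreal C * emeasure PX B"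
    and density_exists: "has_channel_density L N J"
begin

lemma nn_integral_dominated_input:
  assumes "f \<in> borel_measurable L"
  shows "(\<integral>\<^sup>+x. f x \<partial>D.PX) \<le> ennreal C * (\<integral>\<^sup>+x. f x \<partial>PX)"
  using assms dominated by (intro nn_integral_le_of_dominated) simp_all

lemma nn_integral_dominated_input_output:
  assumes f [measurable]: "f \<in> borel_measurable (L \<Otimes>\<^sub>M N)"
  shows "(\<integral>\<^sup>+p. f p \<partial>D.PXY) \<le> ennreal C * (\<integral>\<^sup>+p. f p \<partial>PXY)"
  unfolding nn_integral_input_output_law[OF f] D.nn_integral_input_output_law[OF f]
  by (intro nn_integral_dominated_input nn_integral_kernel_measurable f)

lemma dominated_output:
  assumes B [measurable]: "B \<in> sets N"
  shows "emeasure D.PY B \<le> ennreal C * emeasure PY B"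
proof -
  have "(\<integral>\<^sup>+y. indicator B y \<partial>D.PY) \<le> ennreal C * (\<integral>\<^sup>+y. indicator B y \<partial>PY)"
    by (subst nn_integral_output_law, simp, subst D.nn_integral_output_law, simp,
        rule nn_integral_dominated_input_output) simp
  then show ?thesis by simp
qed

text \<open>The factor by which the denominator \<open>P\<^sub>Y\<close> of the channel density changes.\<close>

definition "output_ratio = RN_deriv PY D.PY"

lemma output_ratio_measurable [measurable]: "output_ratio \<in> borel_measurable N"
  unfolding output_ratio_def using borel_measurable_RN_deriv[of PY D.PY]
  by (simp only: measurable_cong_sets[OF sets_laws(2) refl])

lemma density_output_ratio: "density PY output_ratio = D.PY"
  unfolding output_ratio_def
  by (intro Y.density_RN_deriv absolutely_continuous_of_dominated[where C=C])
    (simp_all add: dominated_output)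

lemma output_ratio_le: "AE y in PY. output_ratio y \<le> ennreal C"
  using dominated_output
  by (intro AE_density_le_of_dominated) (simp_all add: density_output_ratio Y.finite_measure_axioms)

lemma AE_output_ratio: "AE p in D.PXY. 0 < output_ratio (snd p) \<and> output_ratio (snd p) \<le> ennreal C"
proof -
  have "AE y in density PY output_ratio. 0 < output_ratio y \<and> output_ratio y \<le> ennreal C"
    using output_ratio_le by (subst AE_density) auto
  then have "AE y in distr D.PXY N snd. 0 < output_ratio y \<and> output_ratio y \<le> ennreal C"
    unfolding density_output_ratio D.output_law_eq .
  then show ?thesis
    by (rule AE_distrD[rotated]) simp
qed

text \<open>The first derivative \<open>G\<close>, taken with respect to the product of the old laws, still represents the
  new input-output law after only the input factor of the product is exchanged: both sides acquire
  the same factor \<open>dP\<^sub>X' / dP\<^sub>X\<close>, which depends on \<open>x\<close> alone.\<close>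

lemma nn_integral_dominated_eq:
  assumes f [measurable]: "f \<in> borel_measurable (L \<Otimes>\<^sub>M N)"
  shows "(\<integral>\<^sup>+p. f p \<partial>D.PXY) = (\<integral>\<^sup>+x. \<integral>\<^sup>+y. G (x, y) * f (x, y) \<partial>PY \<partial>D.PX)"
proof -
  define k where "k = RN_deriv PX D.PX"
  have k [measurable]: "k \<in> borel_measurable L"
    unfolding k_def using borel_measurable_RN_deriv[of PX D.PX]
    by (simp only: measurable_cong_sets[OF sets_laws(1) refl])
  have k_density: "density PX k = D.PX"
    unfolding k_def
    by (intro X.density_RN_deriv absolutely_continuous_of_dominated[where C=C])
      (simp_all add: dominated)
  note nn_integral_kernel_measurable[OF f, measurable]
  have [measurable]: "(\<lambda>x. \<integral>\<^sup>+y. G (x, y) * f (x, y) \<partial>PY) \<in> borel_measurable L"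
    by (rule Y.borel_measurable_nn_integral) measurable
  have "(\<integral>\<^sup>+p. f p \<partial>D.PXY) = (\<integral>\<^sup>+x. \<integral>\<^sup>+y. f (x, y) \<partial>K x \<partial>density PX k)"
    unfolding k_density by (rule D.nn_integral_input_output_law[OF f])
  also have "\<dots> = (\<integral>\<^sup>+x. k x * (\<integral>\<^sup>+y. f (x, y) \<partial>K x) \<partial>PX)"
    by (rule nn_integral_density) simp_all
  also have "\<dots> = (\<integral>\<^sup>+x. \<integral>\<^sup>+y. k x * f (x, y) \<partial>K x \<partial>PX)"
  proof (rule nn_integral_cong)
    fix x assume "x \<in> space PX"
    then have x: "x \<in> space L" by (simp add: sets_eq_imp_space_eq[OF sets_laws(1)])
    have "(\<lambda>y. f (x, y)) \<in> borel_measurable N"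
      using x by measurable
    then have "(\<lambda>y. f (x, y)) \<in> borel_measurable (K x)"
      by (simp only: measurable_cong_sets[OF kernel_point(1)[OF x] refl])
    then show "k x * (\<integral>\<^sup>+y. f (x, y) \<partial>K x) = (\<integral>\<^sup>+y. k x * f (x, y) \<partial>K x)"
      by (rule nn_integral_cmult[symmetric])
  qed
  also have "\<dots> = (\<integral>\<^sup>+p. k (fst p) * f p \<partial>PXY)"
    by (subst nn_integral_input_output_law) simp_all
  also have "\<dots> = (\<integral>\<^sup>+p. k (fst p) * f p \<partial>density (PX \<Otimes>\<^sub>M PY) G)"
    unfolding density_G[OF density_exists] ..
  also have "\<dots> = (\<integral>\<^sup>+p. G p * (k (fst p) * f p) \<partial>(PX \<Otimes>\<^sub>M PY))"
    by (rule nn_integral_density) measurable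
  also have "\<dots> = (\<integral>\<^sup>+x. \<integral>\<^sup>+y. G (x, y) * (k x * f (x, y)) \<partial>PY \<partial>PX)"
    by (subst Y.nn_integral_fst[symmetric]) simp_all
  also have "\<dots> = (\<integral>\<^sup>+x. k x * (\<integral>\<^sup>+y. G (x, y) * f (x, y) \<partial>PY) \<partial>PX)"
  proof (rule nn_integral_cong)
    fix x assume "x \<in> space PX"
    then have x: "x \<in> space L" by (simp add: sets_eq_imp_space_eq[OF sets_laws(1)])
    have "(\<lambda>y. G (x, y) * f (x, y)) \<in> borel_measurable PY"
      using x by measurable
    then show "(\<integral>\<^sup>+y. G (x, y) * (k x * f (x, y)) \<partial>PY) = k x * (\<integral>\<^sup>+y. G (x, y) * f (x, y) \<partial>PY)"
      by (subst nn_integral_cmult[symmetric]) (simp_all add: ac_simps)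
  qed
  also have "\<dots> = (\<integral>\<^sup>+x. \<integral>\<^sup>+y. G (x, y) * f (x, y) \<partial>PY \<partial>density PX k)"
    by (rule nn_integral_density[symmetric]) simp_all
  finally show ?thesis unfolding k_density .
qed

text \<open>The output factor is exchanged too, by dividing by \<open>dP\<^sub>Y' / dP\<^sub>Y\<close>.  This ratio may vanish, so the
  old output law need not be absolutely continuous with respect to the new one; but the ratio is
  positive almost everywhere under the new output law, and that is where the division happens.\<close>

lemma dominated_channel_density:
  "density (D.PX \<Otimes>\<^sub>M D.PY) (\<lambda>p. G p / output_ratio (snd p)) = D.PXY"
proof (rule measure_eqI)
  fix B assume "B \<in> sets (density (D.PX \<Otimes>\<^sub>M D.PY) (\<lambda>p. G p / output_ratio (snd p)))"
  then have B [measurable]: "B \<in> sets (L \<Otimes>\<^sub>M N)" by simp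
  have "emeasure D.PXY B = (\<integral>\<^sup>+p. indicator B p \<partial>D.PXY)"
    by simp
  also have "\<dots> = (\<integral>\<^sup>+p. indicator B p * (output_ratio (snd p) / output_ratio (snd p)) \<partial>D.PXY)"
  proof (rule nn_integral_cong_AE, rule AE_mp[OF AE_output_ratio], intro AE_I2 impI)
    fix p :: "'x \<times> 'y" assume "0 < output_ratio (snd p) \<and> output_ratio (snd p) \<le> ennreal C"
    then have "output_ratio (snd p) / output_ratio (snd p) = 1"
      by (intro ennreal_divide_self) (auto intro: le_less_trans)
    then show "indicator B p = (indicator B p * (output_ratio (snd p) / output_ratio (snd p)) :: ennreal)"
      by simp
  qed
  also have "\<dots> = (\<integral>\<^sup>+x. \<integral>\<^sup>+y. G (x, y) * (indicator B (x, y) * (output_ratio y / output_ratio y)) \<partial>PY \<partial>D.PX)"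
    by (subst nn_integral_dominated_eq) simp_all
  also have "\<dots> = (\<integral>\<^sup>+x. \<integral>\<^sup>+y. G (x, y) / output_ratio y * indicator B (x, y) \<partial>density PY output_ratio \<partial>D.PX)"
  proof (rule nn_integral_cong)
    fix x assume "x \<in> space D.PX"
    then have x: "x \<in> space L" by (simp add: sets_eq_imp_space_eq[OF D.sets_laws(1)])
    have m: "(\<lambda>y. G (x, y) / output_ratio y * indicator B (x, y)) \<in> borel_measurable PY"
      using x by measurable
    show "(\<integral>\<^sup>+y. G (x, y) * (indicator B (x, y) * (output_ratio y / output_ratio y)) \<partial>PY) =
        (\<integral>\<^sup>+y. G (x, y) / output_ratio y * indicator B (x, y) \<partial>density PY output_ratio)"
      by (subst nn_integral_density[OF _ m]) (simp_all add: divide_ennreal_def ac_simps)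
  qed
  also have "\<dots> = (\<integral>\<^sup>+p. G p / output_ratio (snd p) * indicator B p \<partial>(D.PX \<Otimes>\<^sub>M D.PY))"
    unfolding density_output_ratio by (subst D.Y.nn_integral_fst[symmetric]) simp_all
  also have "\<dots> = emeasure (density (D.PX \<Otimes>\<^sub>M D.PY) (\<lambda>p. G p / output_ratio (snd p))) B"
    by (rule emeasure_density[symmetric]) measurable
  finally show "emeasure (density (D.PX \<Otimes>\<^sub>M D.PY) (\<lambda>p. G p / output_ratio (snd p))) B = emeasure D.PXY B" ..
qed simp

lemma has_channel_density_dominated: "has_channel_density L N D.J"
  unfolding has_channel_density_def
  by (subst dominated_channel_density[symmetric], rule absolutely_continuousI_density) measurable

text \<open>Since \<open>G = output_ratio \<cdot> D.G\<close> and the ratio is at most \<open>C\<close>, the information density drops by at most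
  \<open>ln C\<close>.\<close>

lemma channel_density_loss:
  "AE p in D.PXY. 0 < channel_density L N J (fst p) (snd p) \<and>
     channel_density L N J (fst p) (snd p) \<le> C * channel_density L N D.J (fst p) (snd p)"
proof -
  have "AE p in D.PX \<Otimes>\<^sub>M D.PY. G p / output_ratio (snd p) = D.G p"
    by (intro D.XxY.RN_deriv_unique dominated_channel_density) measurable
  then have "AE p in D.PXY. G p / output_ratio (snd p) = D.G p"
    using has_channel_density_dominated unfolding has_channel_density_def
    by (intro absolutely_continuous_AE[of D.PXY "D.PX \<Otimes>\<^sub>M D.PY"]) simp_all
  with AE_output_ratio D.AE_G_pos_finite[OF has_channel_density_dominated] show ?thesis
  proof eventually_elim
    case (elim p)
    then have r0: "output_ratio (snd p) \<noteq> 0" and rinf: "output_ratio (snd p) \<noteq> top"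
      by (auto simp: top_unique)
    have "G p = output_ratio (snd p) * (G p / output_ratio (snd p))"
      using r0 rinf by (simp add: ennreal_times_divide mult.commute[of "output_ratio _"] ennreal_mult_divide_eq)
    with elim have eq: "G p = output_ratio (snd p) * D.G p" by simp
    then have le: "G p \<le> ennreal C * D.G p"
      using elim by (auto intro!: mult_right_mono)
    have fin: "ennreal C * D.G p < top"
      using elim by (simp add: ennreal_mult_less_top)
    from le fin have Gfin: "G p < top" by (rule le_less_trans)
    have "0 < G p" using eq elim r0 by (simp add: ennreal_zero_less_mult_iff)
    with Gfin have "0 < enn2real (G p)" by (simp add: enn2real_positive_iff)
    moreover have "enn2real (G p) \<le> enn2real (ennreal C * D.G p)"
      using le fin by (intro enn2real_mono) auto
    moreover have "\<dots> = C * enn2real (D.G p)"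
      using C_pos by (simp add: enn2real_mult)
    ultimately show ?case
      by (simp add: channel_density_def)
  qed
qed

end

section \<open>Concentrating the input on the hard source words\<close>

text \<open>An approximate quantile.  The slack \<open>\<delta>\<close> copes with atoms of the law of \<open>h\<close>, at which the tail
  jumps.  The threshold is the first multiple of \<open>\<delta>\<close> at which the tail drops to
  \<open>\<epsilon>\<close>, which is not \<open>0\<close> because the tail at \<open>0\<close> is everything.\<close>

lemma (in prob_space) tail_threshold:
  fixes h :: "'a \<Rightarrow> real"
  assumes h [measurable]: "h \<in> borel_measurable M" and nonneg: "\<And>v. v \<in> space M \<Longrightarrow> 0 \<le> h v"
    and \<epsilon>: "0 < \<epsilon>" "\<epsilon> < 1" and \<delta>: "0 < \<delta>"
  obtains c where "prob {v \<in> space M. c \<le> h v} \<le> \<epsilon>" "\<epsilon> < prob {v \<in> space M. c - \<delta> \<le> h v}"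
proof -
  define B where "B k = {v \<in> space M. real k * \<delta> \<le> h v}" for k :: nat
  have "decseq B"
  proof (rule antimonoI)
    fix j k :: nat assume "j \<le> k"
    then have "real j * \<delta> \<le> real k * \<delta>" using \<delta> by (intro mult_right_mono) auto
    then show "B k \<subseteq> B j" by (auto simp: B_def)
  qed
  moreover have "range B \<subseteq> sets M" by (auto simp: B_def)
  ultimately have "(\<lambda>k. prob (B k)) \<longlonglongrightarrow> prob (\<Inter>k. B k)"
    by (intro finite_Lim_measure_decseq)
  moreover have "(\<Inter>k. B k) = {}"
  proof -
    have "\<exists>k. v \<notin> B k" for v
    proof -
      obtain k where "h v < real k * \<delta>" using reals_Archimedean3[OF \<delta>] by blast
      then have "v \<notin> B k" by (simp add: B_def)
      then show ?thesis ..
    qed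
    then show ?thesis by auto
  qed
  ultimately have "(\<lambda>k. prob (B k)) \<longlonglongrightarrow> 0" by simp
  then have "eventually (\<lambda>k. prob (B k) < \<epsilon>) sequentially"
    using \<epsilon> by (intro order_tendstoD)
  then obtain k0 where "prob (B k0) \<le> \<epsilon>"
    by (auto simp: eventually_sequentially intro: less_imp_le)
  define k where "k = (LEAST k. prob (B k) \<le> \<epsilon>)"
  have k: "prob (B k) \<le> \<epsilon>" unfolding k_def by (rule LeastI) fact
  have "B 0 = space M" using nonneg by (auto simp: B_def)
  then have "k \<noteq> 0" using k \<epsilon> prob_space by (intro notI) simp
  then obtain j where j: "k = Suc j" by (cases k) auto
  have "\<epsilon> < prob (B j)"
    using not_less_Least[of j "\<lambda>k. prob (B k) \<le> \<epsilon>"] j unfolding k_def by auto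
  moreover have "real j * \<delta> = real k * \<delta> - \<delta>" by (simp add: j algebra_simps)
  ultimately show thesis using k that[of "real k * \<delta>"] by (simp add: B_def)
qed

lemma distr_pair_snd_prob:
  assumes "prob_space M" "prob_space M'"
  shows "distr (M \<Otimes>\<^sub>M M') M' snd = M'"
proof (rule measure_eqI)
  interpret M: prob_space M by fact
  interpret M': prob_space M' by fact
  fix B assume "B \<in> sets (distr (M \<Otimes>\<^sub>M M') M' snd)"
  then have B: "B \<in> sets M'" by simp
  then have "snd -` B \<inter> space (M \<Otimes>\<^sub>M M') = space M \<times> B"
    using sets.sets_into_space[OF B] by (auto simp: space_pair_measure)
  then show "emeasure (distr (M \<Otimes>\<^sub>M M') M' snd) B = emeasure M' B"
    using B by (simp add: emeasure_distr M'.emeasure_pair_measure_Times M.emeasure_space_1)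
qed simp

text \<open>The one-block form of the converse.  The three losses of \<open>\<delta>\<close>, one in the definition of the
  quantile event, one from the change of output law and one in reserve to keep the arithmetic
  even, are what separates \<open>4 \<delta>\<close> from \<open>2 \<delta>\<close>.\<close>

lemma (in coded_channel) concentrate_input:
  assumes h [measurable]: "h \<in> borel_measurable Vs" and nonneg: "\<And>v. 0 \<le> h v"
    and t: "0 < t" and \<epsilon>: "0 < \<epsilon>" "\<epsilon> < 1" and \<delta>: "0 < \<delta>" and exp: "exp (- (t * \<delta>)) \<le> \<epsilon>"
    and dens: "has_channel_density L N J"
  shows "\<exists>Q' c. Q' \<in> space (prob_algebra (Vs \<Otimes>\<^sub>M L)) \<and> distr Q' Vs fst = distr Q Vs fst \<and>
    has_channel_density L N (joint_law Q' N K) \<and>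
    \<P>(w in joint_law Q' N K. c \<le> h (fst (fst w))) \<le> \<epsilon> \<and>
    \<P>(w in joint_law Q' N K.
        1 / t * ln (channel_density L N (joint_law Q' N K) (snd (fst w)) (snd w)) \<le> c + 2 * \<delta>)
      \<le> \<P>(w in J. 1 / t * ln (channel_density L N J (snd (fst w)) (snd w))
             \<le> h (fst (fst w)) + 4 * \<delta>) / \<epsilon>"
proof -
  have [measurable]: "(\<lambda>z. h (fst z)) \<in> borel_measurable Q" by measurable
  obtain c where c: "Q.prob {z \<in> space Q. c \<le> h (fst z)} \<le> \<epsilon>"
      "\<epsilon> < Q.prob {z \<in> space Q. c - \<delta> \<le> h (fst z)}"
    using Q.tail_threshold[of "\<lambda>z. h (fst z)" \<epsilon> \<delta>] nonneg \<epsilon> \<delta> by auto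
  define E where "E = {z \<in> space Q. c - \<delta> \<le> h (fst z)}"
  have E [measurable]: "E \<in> sets Q" unfolding E_def by measurable
  have qE: "\<epsilon> < Q.prob E" using c(2) by (simp add: E_def)
  have E0: "emeasure Q E \<noteq> 0"
    using qE \<epsilon> by (simp add: Q.emeasure_eq_measure)
  have E_large: "inverse (emeasure Q E) \<le> ennreal (1 / \<epsilon>)"
    using qE \<epsilon> by (simp add: Q.emeasure_eq_measure inverse_ennreal ennreal_leI le_imp_inverse_le
        flip: inverse_eq_divide)
  define \<mu> where "\<mu> = distr (uniform_measure Q E) L snd"
  have sets_\<mu> [measurable_cong, simp]: "sets \<mu> = sets L" by (simp add: \<mu>_def)
  interpret U: prob_space "uniform_measure Q E"
    using E0 by (intro prob_space_uniform_measure) simp_all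
  interpret \<mu>: prob_space \<mu>
    unfolding \<mu>_def by (rule U.prob_space_distr) measurable
  have conditioned: "(\<integral>\<^sup>+x. f x \<partial>\<mu>) \<le> ennreal (1 / \<epsilon>) * (\<integral>\<^sup>+z. f (snd z) * indicator E z \<partial>Q)"
    if f [measurable]: "f \<in> borel_measurable L" for f
  proof -
    have "(\<integral>\<^sup>+x. f x \<partial>\<mu>) = (\<integral>\<^sup>+z. f (snd z) \<partial>uniform_measure Q E)"
      unfolding \<mu>_def by (rule nn_integral_distr) measurable
    also have "\<dots> = (\<integral>\<^sup>+z. f (snd z) * indicator E z \<partial>Q) / emeasure Q E"
      by (rule nn_integral_uniform_measure) measurable
    also have "\<dots> \<le> ennreal (1 / \<epsilon>) * (\<integral>\<^sup>+z. f (snd z) * indicator E z \<partial>Q)"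
      unfolding divide_ennreal_def using E_large by (subst mult.commute) (intro mult_right_mono, simp_all)
    finally show ?thesis .
  qed
  define PV where "PV = distr Q Vs fst"
  interpret PV: prob_space PV
    unfolding PV_def by (rule Q.prob_space_distr) measurable
  have sets_PV [measurable_cong, simp]: "sets PV = sets Vs" by (simp add: PV_def)
  \<comment> \<open>Any coupling of the source with the conditioned input would do; the independent one is the
    simplest.\<close>
  define Q' where "Q' = PV \<Otimes>\<^sub>M \<mu>"
  have sets_Q': "sets Q' = sets (Vs \<Otimes>\<^sub>M L)"
    unfolding Q'_def by (intro sets_pair_measure_cong) simp_all
  interpret P: pair_prob_space PV \<mu> ..
  have Q': "Q' \<in> space (prob_algebra (Vs \<Otimes>\<^sub>M L))"
    using sets_Q' P.prob_space_axioms by (simp add: space_prob_algebra Q'_def)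
  interpret D: coded_channel L N K Vs Q'
    by unfold_locales (rule Q')
  have "distr Q' Vs fst = distr Q' PV fst"
    by (rule distr_cong) simp_all
  then have marg: "distr Q' Vs fst = PV"
    unfolding Q'_def by (simp only: \<mu>.distr_pair_fst)
  have "distr Q' L snd = distr Q' \<mu> snd"
    by (rule distr_cong) simp_all
  then have input: "D.PX = \<mu>"
    unfolding D.input_law_eq unfolding Q'_def
    by (simp only: distr_pair_snd_prob[OF PV.prob_space_axioms \<mu>.prob_space_axioms])
  have "emeasure D.PX B \<le> ennreal (1 / \<epsilon>) * emeasure PX B" if B [measurable]: "B \<in> sets L" for B
  proof -
    have "emeasure D.PX B = (\<integral>\<^sup>+x. indicator B x \<partial>\<mu>)"
      using B by (simp add: input)
    also have "\<dots> \<le> ennreal (1 / \<epsilon>) * (\<integral>\<^sup>+z. indicator B (snd z) * indicator E z \<partial>Q)"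
      by (rule conditioned) measurable
    also have "\<dots> \<le> ennreal (1 / \<epsilon>) * (\<integral>\<^sup>+z. indicator B (snd z) \<partial>Q)"
      by (intro mult_left_mono nn_integral_mono) (auto split: split_indicator)
    also have "(\<integral>\<^sup>+z. indicator B (snd z) \<partial>Q) = (\<integral>\<^sup>+x. indicator B x \<partial>distr Q L snd)"
      by (rule nn_integral_distr[symmetric]) measurable
    also have "\<dots> = emeasure PX B"
      using B by (simp add: input_law_eq)
    finally show ?thesis .
  qed
  then interpret dominated_input L N K Vs Q Q' "1 / \<epsilon>"
    using \<epsilon> dens by unfold_locales simp_all

  have tail: "\<P>(w in D.J. c \<le> h (fst (fst w))) \<le> \<epsilon>"
  proof -
    have "\<P>(w in D.J. c \<le> h (fst (fst w))) = measure (distr (distr D.J (Vs \<Otimes>\<^sub>M L) fst) Vs fst) {v \<in> space Vs. c \<le> h v}"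
      by (subst distr_distr, simp, simp, subst measure_distr)
        (auto intro!: arg_cong[where f="measure D.J"] simp: space_pair_measure sets_eq_imp_space_eq[OF D.sets_joint_law])
    also have "\<dots> = measure (distr Q Vs fst) {v \<in> space Vs. c \<le> h v}"
      unfolding D.distr_coupling marg PV_def ..
    also have "\<dots> = Q.prob {z \<in> space Q. c \<le> h (fst z)}"
      by (subst measure_distr) (auto intro!: arg_cong[where f="measure Q"] simp: space_Q)
    finally show ?thesis using c(1) by simp
  qed

  \<comment> \<open>\<open>B'\<close> is the bad event for the new density; up to a null set it lies in \<open>B\<close>, which is
    expressed by the old density, and on the conditioning event \<open>B\<close> lies in \<open>Bad\<close>.\<close>
  define Bad where "Bad = {w \<in> space J. 1 / t * ln (channel_density L N J (snd (fst w)) (snd w)) \<le> h (fst (fst w)) + 4 * \<delta>}"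
  define B' where "B' = {p \<in> space (L \<Otimes>\<^sub>M N). 1 / t * ln (channel_density L N D.J (fst p) (snd p)) \<le> c + 2 * \<delta>}"
  define B where "B = {p \<in> space (L \<Otimes>\<^sub>M N). 1 / t * ln (channel_density L N J (fst p) (snd p)) \<le> c + 3 * \<delta>}"
  note channel_density_measurable[unfolded split_beta', measurable]
  note D.channel_density_measurable[unfolded split_beta', measurable]
  note channel_density_joint_measurable[measurable]
  have [measurable]: "B' \<in> sets (L \<Otimes>\<^sub>M N)" unfolding B'_def by measurable
  have [measurable]: "B \<in> sets (L \<Otimes>\<^sub>M N)" unfolding B_def by measurable
  have [measurable]: "Bad \<in> sets J" unfolding Bad_def by measurable

  have "emeasure D.J {w \<in> space D.J.
        1 / t * ln (channel_density L N D.J (snd (fst w)) (snd w)) \<le> c + 2 * \<delta>} = emeasure D.PXY B'"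
    unfolding D.laws_by_projections
    by (subst emeasure_distr)
      (auto intro!: arg_cong[where f="emeasure D.J"] simp: B'_def space_pair_measure sets_eq_imp_space_eq[OF D.sets_joint_law])
  also have "\<dots> \<le> emeasure D.PXY B"
  proof (rule emeasure_mono_AE)
    show "AE p in D.PXY. p \<in> B' \<longrightarrow> p \<in> B"
      using channel_density_loss
    proof eventually_elim
      case (elim p)
      let ?g = "channel_density L N J (fst p) (snd p)" and ?g' = "channel_density L N D.J (fst p) (snd p)"
      have pos: "0 < ?g'"
        using elim \<epsilon> by (smt (verit) mult_nonneg_nonpos divide_pos_pos)
      have "ln ?g \<le> ln (1 / \<epsilon> * ?g')"
        using elim by (intro ln_mono) auto
      also have "\<dots> = - ln \<epsilon> + ln ?g'"
        using \<epsilon> pos by (simp add: ln_mult ln_div)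
      also have "- ln \<epsilon> \<le> t * \<delta>"
        using ln_mono[OF exp] by simp
      finally have "ln ?g \<le> t * \<delta> + ln ?g'" by simp
      then have "1 / t * ln ?g \<le> \<delta> + 1 / t * ln ?g'"
        using t by (simp add: field_simps)
      then show ?case by (auto simp: B'_def B_def)
    qed
  qed simp
  also have "\<dots> = (\<integral>\<^sup>+p. indicator B p \<partial>D.PXY)"
    by simp
  also have "\<dots> = (\<integral>\<^sup>+x. \<integral>\<^sup>+y. indicator B (x, y) \<partial>K x \<partial>\<mu>)"
    unfolding input[symmetric] by (rule D.nn_integral_input_output_law) measurable
  also have "\<dots> \<le> ennreal (1 / \<epsilon>) *
      (\<integral>\<^sup>+z. (\<integral>\<^sup>+y. indicator B (snd z, y) \<partial>K (snd z)) * indicator E z \<partial>Q)"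
    by (rule conditioned, rule nn_integral_kernel_measurable) measurable
  also have "(\<integral>\<^sup>+z. (\<integral>\<^sup>+y. indicator B (snd z, y) \<partial>K (snd z)) * indicator E z \<partial>Q) =
      (\<integral>\<^sup>+z. \<integral>\<^sup>+y. indicator B (snd z, y) * indicator E z \<partial>K (snd z) \<partial>Q)"
    by (intro nn_integral_cong) (auto split: split_indicator)
  also have "\<dots> = (\<integral>\<^sup>+w. indicator B (snd (fst w), snd w) * indicator E (fst w) \<partial>J)"
    by (subst nn_integral_joint_law) simp_all
  also have "\<dots> \<le> (\<integral>\<^sup>+w. indicator Bad w \<partial>J)"
    by (intro nn_integral_mono) (auto simp: B_def E_def Bad_def split: split_indicator)
  also have "\<dots> = emeasure J Bad"
    by simp
  finally have "ennreal (\<P>(w in D.J.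
        1 / t * ln (channel_density L N D.J (snd (fst w)) (snd w)) \<le> c + 2 * \<delta>))
      \<le> ennreal (1 / \<epsilon>) * ennreal (J.prob Bad)"
    by (simp add: D.J.emeasure_eq_measure J.emeasure_eq_measure mult_left_mono)
  then have "\<P>(w in D.J. 1 / t * ln (channel_density L N D.J (snd (fst w)) (snd w)) \<le> c + 2 * \<delta>)
      \<le> J.prob Bad / \<epsilon>"
    using \<epsilon> by (simp add: ennreal_mult[symmetric] ennreal_le_iff divide_ennreal)
  with Q' marg has_channel_density_dominated tail show ?thesis
    unfolding PV_def Bad_def by blast
qed

section \<open>Equivalence of the two conditions\<close>

text \<open>A finite power of a countable discrete space is again discrete, so the source entropy density is
  measurable for free.\<close>

lemma borel_measurable_block_countable:
  fixes f :: "(nat \<Rightarrow> 'v) \<Rightarrow> 'b :: topological_space"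
  assumes "countable A"
  shows "f \<in> borel_measurable (block_space (count_space A) n)"
  using assms by (simp add: block_space_def count_space_PiM_finite)

lemma prob_by_projections:
  "\<P>(((v, x), y) in M. P v x y) = \<P>(w in M. P (fst (fst w)) (snd (fst w)) (snd w))"
  by (rule arg_cong[where f="measure M"]) auto

theorem theorem4p3:
  fixes A :: "'v set"
    and MX :: "'x measure"
    and MY :: "'y measure"
    and PV :: "nat \<Rightarrow> (nat \<Rightarrow> 'v) measure"
    and W :: "nat \<Rightarrow> (nat \<Rightarrow> 'x) \<Rightarrow> (nat \<Rightarrow> 'y) measure"
  assumes "countable A" and "infinite A"
    and "general_source A PV"
    and "general_channel MX MY W"
  defines "J \<equiv> \<lambda>Q n. joint_law (Q n) (block_space MY n) (W n)"
  defines "g \<equiv> \<lambda>Q n. channel_density (block_space MX n) (block_space MY n) (J Q n)"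
  shows
    "(\<exists>Q \<gamma>. channel_input A PV MX Q \<and>
        (\<forall>n\<ge>1. has_channel_density (block_space MX n) (block_space MY n) (J Q n)) \<and>
        admissible_gap \<gamma> \<and>
        (\<lambda>n. \<P>(((v, x), y) in J Q n.
               1 / real n * ln (g Q n x y) \<le> 1 / real n * ln (1 / measure (PV n) {v}) + \<gamma> n))
          \<longlonglongrightarrow> 0)
     \<longleftrightarrow>
     (\<exists>Q c \<gamma>. channel_input A PV MX Q \<and>
        (\<forall>n\<ge>1. has_channel_density (block_space MX n) (block_space MY n) (J Q n)) \<and>
        admissible_gap \<gamma> \<and>
        (\<lambda>n. \<P>(((v, x), y) in J Q n. 1 / real n * ln (1 / measure (PV n) {v}) \<ge> c n) +
             \<P>(((v, x), y) in J Q n. 1 / real n * ln (g Q n x y) \<le> c n + \<gamma> n))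
          \<longlonglongrightarrow> 0)"
proof -
  have coded: "coded_channel (block_space MX n) (block_space MY n) (W n) (block_space (count_space A) n) (Q n)"
    if "channel_input A PV MX Q" "1 \<le> n" for Q n
    using that assms(4) by unfold_locales (auto simp: channel_input_def general_channel_def)
  define h where "h n v = 1 / real n * ln (1 / measure (PV n) {v})" for n v
  have h_nonneg: "0 \<le> h n v" if "1 \<le> n" for n v
  proof (cases "measure (PV n) {v} = 0")
    case False
    have "prob_space (PV n)"
      using assms(3) that by (auto simp: general_source_def space_prob_algebra)
    then have "measure (PV n) {v} \<le> 1" by (rule prob_space.prob_le_1)
    with False have "1 \<le> 1 / measure (PV n) {v}"
      by (simp add: order_less_le)
    then show ?thesis by (simp add: h_def)
    \<comment> \<open>On a null word \<open>1 / 0 = 0\<close> and \<open>ln 0 = 0\<close>, so \<open>h\<close> vanishes there.\<close>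
  qed (simp add: h_def)
  have h_measurable: "h n \<in> borel_measurable (block_space (count_space A) n)" for n
    by (rule borel_measurable_block_countable[OF assms(1)])
  define T where "T Q c n = \<P>(w in J Q n. c \<le> h n (fst (fst w)))" for Q c n
  define I where "I Q c n = \<P>(w in J Q n. 1 / real n * ln (g Q n (snd (fst w)) (snd w)) \<le> c)" for Q c n
  define p where "p Q \<gamma> n = \<P>(w in J Q n.
      1 / real n * ln (g Q n (snd (fst w)) (snd w)) \<le> h n (fst (fst w)) + \<gamma> n)"
    for Q and \<gamma> :: "nat \<Rightarrow> real" and n
  have nonneg: "0 \<le> T Q c n" "0 \<le> I Q c n" "0 \<le> p Q \<gamma> n" for Q c n \<gamma>
    by (simp_all add: T_def I_def p_def)
  let ?dens = "\<lambda>Q. \<forall>n\<ge>1. has_channel_density (block_space MX n) (block_space MY n) (J Q n)"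
  have "(\<exists>Q \<gamma>. channel_input A PV MX Q \<and> ?dens Q \<and> admissible_gap \<gamma> \<and> p Q \<gamma> \<longlonglongrightarrow> 0) \<longleftrightarrow>
    (\<exists>Q c \<gamma>. channel_input A PV MX Q \<and> ?dens Q \<and> admissible_gap \<gamma> \<and>
      (\<lambda>n. T Q (c n) n + I Q (c n + \<gamma> n) n) \<longlonglongrightarrow> 0)"
  proof (intro iffI; elim exE conjE)
    fix Q c \<gamma>
    assume Q: "channel_input A PV MX Q" and dens: "?dens Q" and gap: "admissible_gap \<gamma>"
      and lim: "(\<lambda>n. T Q (c n) n + I Q (c n + \<gamma> n) n) \<longlonglongrightarrow> 0"
    have "p Q \<gamma> n \<le> T Q (c n) n + I Q (c n + \<gamma> n) n" if n: "1 \<le> n" for n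
    proof -
      interpret coded_channel "block_space MX n" "block_space MY n" "W n"
        "block_space (count_space A) n" "Q n"
        by (rule coded[OF Q n])
      note h_measurable[of n, measurable] channel_density_joint_measurable[measurable]
      show ?thesis
        unfolding p_def T_def I_def g_def J_def
        by (rule order_trans[OF J.finite_measure_mono measure_Un_le]) auto
    qed
    then have "p Q \<gamma> \<longlonglongrightarrow> 0"
      by (intro tendsto_sandwich[OF _ _ tendsto_const lim])
        (auto simp: eventually_sequentially nonneg)
    with Q dens gap
    show "\<exists>Q \<gamma>. channel_input A PV MX Q \<and> ?dens Q \<and> admissible_gap \<gamma> \<and> p Q \<gamma> \<longlonglongrightarrow> 0"
      by blast
  next
    fix Q \<gamma>
    assume Q: "channel_input A PV MX Q" and dens: "?dens Q" and gap: "admissible_gap \<gamma>"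
      and lim: "p Q \<gamma> \<longlonglongrightarrow> 0"
    \<comment> \<open>The first term gives \<open>p / \<epsilon> \<le> sqrt p\<close>, the second \<open>ln (1 / \<epsilon>) \<le> n \<gamma> / 4\<close>.\<close>
    define \<epsilon> where "\<epsilon> n = max (sqrt (p Q \<gamma> n)) (exp (- (real n * (\<gamma> n / 4))))" for n
    have \<epsilon>_pos: "0 < \<epsilon> n" for n by (simp add: \<epsilon>_def less_max_iff_disj)
    have sqrt_lim: "(\<lambda>n. sqrt (p Q \<gamma> n)) \<longlonglongrightarrow> 0"
      using tendsto_real_sqrt[OF lim] by simp
    have "filterlim (\<lambda>n. real n * \<gamma> n) at_top sequentially"
      using gap by (simp add: admissible_gap_def)
    moreover have "((\<lambda>y :: real. exp (- (y / 4))) \<longlongrightarrow> 0) at_top"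
      by real_asymp
    ultimately have "(\<lambda>n. exp (- (real n * \<gamma> n / 4))) \<longlonglongrightarrow> 0"
      by (rule filterlim_compose[rotated])
    then have "(\<lambda>n. exp (- (real n * (\<gamma> n / 4)))) \<longlonglongrightarrow> 0"
      by simp
    then have \<epsilon>_lim: "\<epsilon> \<longlonglongrightarrow> 0"
      using tendsto_max[OF sqrt_lim] unfolding \<epsilon>_def by fastforce
    \<comment> \<open>In the finitely many blocks with \<open>\<epsilon> n \<ge> 1\<close> the input is left unchanged: there it only has to
      be an admissible input whose channel density exists.\<close>
    define good where "good n q c \<longleftrightarrow> (1 \<le> n \<longrightarrow> q \<in> space (prob_algebra (block_space (count_space A) n \<Otimes>\<^sub>M block_space MX n)) \<and>
        distr q (block_space (count_space A) n) fst = PV n \<and>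
        has_channel_density (block_space MX n) (block_space MY n) (joint_law q (block_space MY n) (W n)) \<and>
        (\<epsilon> n < 1 \<longrightarrow>
          \<P>(w in joint_law q (block_space MY n) (W n). c \<le> h n (fst (fst w))) \<le> \<epsilon> n \<and>
          \<P>(w in joint_law q (block_space MY n) (W n). 1 / real n *
              ln (channel_density (block_space MX n) (block_space MY n)
                (joint_law q (block_space MY n) (W n)) (snd (fst w)) (snd w)) \<le> c + \<gamma> n / 2)
            \<le> p Q \<gamma> n / \<epsilon> n))" for n q c
    have "\<exists>q c. good n q c" for n
    proof (cases "1 \<le> n \<and> \<epsilon> n < 1")
      case True
      then have n: "1 \<le> n" by simp
      interpret coded_channel "block_space MX n" "block_space MY n" "W n"
        "block_space (count_space A) n" "Q n"
        by (rule coded[OF Q n])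
      have \<gamma>: "0 < \<gamma> n" using gap n by (simp add: admissible_gap_def)
      have marg: "distr (Q n) (block_space (count_space A) n) fst = PV n"
        using Q n by (simp add: channel_input_def)
      have dens_n: "has_channel_density (block_space MX n) (block_space MY n) (J Q n)"
        using dens n by (simp add: J_def)
      show ?thesis
        using concentrate_input[OF h_measurable h_nonneg[OF n], of "real n" "\<epsilon> n" "\<gamma> n / 4"]
          True \<epsilon>_pos \<gamma> dens_n
        unfolding good_def marg p_def J_def g_def by (auto simp: \<epsilon>_def)
    next
      case False
      then show ?thesis
        using Q dens by (intro exI[of _ "Q n"]) (auto simp: good_def channel_input_def J_def)
    qed
    then obtain Q' c where "\<And>n. good n (Q' n) (c n)" by metis
    then have Q'c: "1 \<le> n \<longrightarrow>
        Q' n \<in> space (prob_algebra (block_space (count_space A) n \<Otimes>\<^sub>M block_space MX n)) \<and>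
        distr (Q' n) (block_space (count_space A) n) fst = PV n \<and>
        has_channel_density (block_space MX n) (block_space MY n) (J Q' n) \<and>
        (\<epsilon> n < 1 \<longrightarrow> T Q' (c n) n \<le> \<epsilon> n \<and> I Q' (c n + \<gamma> n / 2) n \<le> p Q \<gamma> n / \<epsilon> n)" for n
      unfolding good_def T_def I_def J_def g_def by simp
    have input: "channel_input A PV MX Q'" and dens': "?dens Q'"
      using Q'c by (auto simp: channel_input_def)
    have gap': "admissible_gap (\<lambda>n. \<gamma> n / 2)"
    proof -
      have "filterlim (\<lambda>n. real n * \<gamma> n) at_top sequentially"
        using gap by (simp add: admissible_gap_def)
      moreover have "filterlim (\<lambda>y :: real. y / 2) at_top at_top"
        by real_asymp
      ultimately have "filterlim (\<lambda>n. real n * \<gamma> n / 2) at_top sequentially"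
        by (rule filterlim_compose[rotated])
      then show ?thesis
        using gap by (auto simp: admissible_gap_def intro: tendsto_divide_zero)
    qed
    have "eventually (\<lambda>n. \<epsilon> n < 1) sequentially"
      using order_tendstoD(2)[OF \<epsilon>_lim, of 1] by simp
    then have "eventually (\<lambda>n. T Q' (c n) n + I Q' (c n + \<gamma> n / 2) n \<le> \<epsilon> n + sqrt (p Q \<gamma> n)) sequentially"
      using eventually_ge_at_top[of "1::nat"]
    proof eventually_elim
      case (elim n)
      have "p Q \<gamma> n = sqrt (p Q \<gamma> n) * sqrt (p Q \<gamma> n)"
        by (simp add: nonneg)
      also have "\<dots> \<le> sqrt (p Q \<gamma> n) * \<epsilon> n"
        by (intro mult_left_mono) (simp_all add: \<epsilon>_def nonneg)
      finally have "p Q \<gamma> n / \<epsilon> n \<le> sqrt (p Q \<gamma> n)"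
        using \<epsilon>_pos[of n] by (simp add: divide_le_eq)
      then show ?case
        using Q'c[of n] elim by auto
    qed
    moreover have "(\<lambda>n. \<epsilon> n + sqrt (p Q \<gamma> n)) \<longlonglongrightarrow> 0"
      using tendsto_add[OF \<epsilon>_lim sqrt_lim] by simp
    ultimately have "(\<lambda>n. T Q' (c n) n + I Q' (c n + \<gamma> n / 2) n) \<longlonglongrightarrow> 0"
      by (rule tendsto_sandwich[OF always_eventually _ tendsto_const, rotated])
        (simp add: nonneg)
    with input dens' gap'
    have "channel_input A PV MX Q' \<and> ?dens Q' \<and> admissible_gap (\<lambda>n. \<gamma> n / 2) \<and>
      (\<lambda>n. T Q' (c n) n + I Q' (c n + \<gamma> n / 2) n) \<longlonglongrightarrow> 0"
      by (intro conjI)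
    then show "\<exists>Q c \<gamma>. channel_input A PV MX Q \<and> ?dens Q \<and> admissible_gap \<gamma> \<and>
      (\<lambda>n. T Q (c n) n + I Q (c n + \<gamma> n) n) \<longlonglongrightarrow> 0"
      by (intro exI)
  qed
  then show ?thesis
    unfolding p_def T_def I_def h_def prob_by_projections .
qed

end
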